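(* Let $\Delta\subset\mathbb{R}^n$ be a lattice polytope, let $\mathcal{P}$ be a lattice simplicial decomposition of $\Delta$, and let $\mu$ be a weighting of $\mathcal{P}$ with $|\mu|=|\Delta|-1$. Then the following are equivalent: (1) $\mu$ is rigid. (2) $\operatorname{Supp}(\mu)$ is connected. (3) $\operatorname{Supp}(\mu)$ is connected and $\mu$ is full.
   Context: For a lattice polytope $P$, $|P|$ is the number of lattice points in $P$; $\mathbb{Z}(\Delta)=\Delta\cap\mathbb{Z}^n$. A lattice polyhedral decomposition of $\Delta$ is a finite polyhedral complex of nonempty lattice polytopes with union $\Delta$; it is lattice simplicial if for every $d$ each $d$-dimensional cell contains exactly $d+1$ lattice points. A weighting of $\mathcal{P}$ is a map $\mu:\mathcal{P}\to\mathbb{Z}$ with $0\le\mu(P)\le|P|-1$ for all $P\in\mathcal{P}$, and $|\mu|=\sum_{P\in\mathcal{P}}\mu(P)$. Let $\mathcal{P}^0$ be the set of vertices of $\mathcal{P}$. A nonempty subset $L\subset\mathbb{Z}(\Delta)$ that does not contain $\mathcal{P}^0$ is deformable (with respect to $\mu$) if for every $P\in\mathcal{P}$ either $|P\cap L|=0$ or $|P\cap L|\ge\mu(P)+1$. $\mu$ is rigid if no such $L$ is deformable. A cell $P\in\mathcal{P}$ is full if $\mu(P)=|P|-1$. $\mu$ is full if for every $P\in\mathcal{P}$ either $\mu(P)=|P|-1$ or $\mu(P)=0$. $\operatorname{Supp}(\mu)=\bigcup_{P\text{ full}}P\subset\Delta$ (in particular it contains every vertex of $\mathcal{P}$). *)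

theory Defs
  imports "HOL-Analysis.Analysis"
begin

definition lattice_points :: "(real^'n) set \<Rightarrow> (real^'n) set" where
  "lattice_points S = {x \<in> S. \<forall>i. x $ i \<in> \<int>}"

definition num_lattice_points :: "(real^'n) set \<Rightarrow> nat" where
  "num_lattice_points S = card (lattice_points S)"

text \<open>As for the library's \<^const>\<open>polytope\<close>, the empty set counts as a lattice polytope.\<close>

definition lattice_polytope :: "(real^'n) set \<Rightarrow> bool" where
  "lattice_polytope P \<longleftrightarrow> (\<exists>V. finite V \<and> V \<subseteq> lattice_points UNIV \<and> P = convex hull V)"

text \<open>The empty face is left out of the complex, so closure under faces and the
  intersection condition are restricted to nonempty faces.\<close>

definition lattice_polyhedral_decomposition ::
    "(real^'n) set \<Rightarrow> (real^'n) set set \<Rightarrow> bool" where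
  "lattice_polyhedral_decomposition \<Delta> \<P> \<longleftrightarrow>
     finite \<P> \<and>
     (\<forall>P\<in>\<P>. lattice_polytope P \<and> P \<noteq> {}) \<and>
     (\<forall>P\<in>\<P>. \<forall>F. F face_of P \<and> F \<noteq> {} \<longrightarrow> F \<in> \<P>) \<and>
     (\<forall>P\<in>\<P>. \<forall>Q\<in>\<P>. P \<inter> Q \<noteq> {} \<longrightarrow> (P \<inter> Q) face_of P \<and> (P \<inter> Q) face_of Q) \<and>
     \<Union>\<P> = \<Delta>"

definition lattice_simplicial_decomposition ::
    "(real^'n) set \<Rightarrow> (real^'n) set set \<Rightarrow> bool" where
  "lattice_simplicial_decomposition \<Delta> \<P> \<longleftrightarrow>
     lattice_polyhedral_decomposition \<Delta> \<P> \<and>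
     (\<forall>d::nat. \<forall>P\<in>\<P>. aff_dim P = int d \<longrightarrow> num_lattice_points P = d + 1)"

definition complex_vertices :: "(real^'n) set set \<Rightarrow> (real^'n) set" where
  "complex_vertices \<P> = {v. {v} \<in> \<P>}"

definition weighting :: "(real^'n) set set \<Rightarrow> ((real^'n) set \<Rightarrow> int) \<Rightarrow> bool" where
  "weighting \<P> \<mu> \<longleftrightarrow> (\<forall>P\<in>\<P>. 0 \<le> \<mu> P \<and> \<mu> P \<le> int (num_lattice_points P) - 1)"

definition total_weight :: "(real^'n) set set \<Rightarrow> ((real^'n) set \<Rightarrow> int) \<Rightarrow> int" where
  "total_weight \<P> \<mu> = (\<Sum>P\<in>\<P>. \<mu> P)"

definition deformable ::
    "(real^'n) set \<Rightarrow> (real^'n) set set \<Rightarrow> ((real^'n) set \<Rightarrow> int) \<Rightarrow> (real^'n) set \<Rightarrow> bool" where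
  "deformable \<Delta> \<P> \<mu> L \<longleftrightarrow>
     L \<noteq> {} \<and> L \<subseteq> lattice_points \<Delta> \<and> \<not> complex_vertices \<P> \<subseteq> L \<and>
     (\<forall>P\<in>\<P>. num_lattice_points (P \<inter> L) = 0 \<or>
              int (num_lattice_points (P \<inter> L)) \<ge> \<mu> P + 1)"

definition rigid ::
    "(real^'n) set \<Rightarrow> (real^'n) set set \<Rightarrow> ((real^'n) set \<Rightarrow> int) \<Rightarrow> bool" where
  "rigid \<Delta> \<P> \<mu> \<longleftrightarrow> \<not> (\<exists>L. deformable \<Delta> \<P> \<mu> L)"

definition full_cell :: "((real^'n) set \<Rightarrow> int) \<Rightarrow> (real^'n) set \<Rightarrow> bool" where
  "full_cell \<mu> P \<longleftrightarrow> \<mu> P = int (num_lattice_points P) - 1"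

definition full_weighting :: "(real^'n) set set \<Rightarrow> ((real^'n) set \<Rightarrow> int) \<Rightarrow> bool" where
  "full_weighting \<P> \<mu> \<longleftrightarrow>
     (\<forall>P\<in>\<P>. \<mu> P = int (num_lattice_points P) - 1 \<or> \<mu> P = 0)"

definition weighting_support :: "(real^'n) set set \<Rightarrow> ((real^'n) set \<Rightarrow> int) \<Rightarrow> (real^'n) set" where
  "weighting_support \<P> \<mu> = \<Union>{P \<in> \<P>. full_cell \<mu> P}"

end

theory Submission
  imports Defs
begin

text \<open>
  A cell that has only \<open>d + 1\<close> lattice points in dimension \<open>d\<close> is a simplex whose lattice points
  are its vertices. Hence the lattice points of \<open>\<Delta>\<close> are the vertices of \<open>\<P>\<close>, and everything can be
  phrased for the hypergraph on the finite set \<open>V\<close> of lattice points whose edges are the cells.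
  Rigidity says that no nonempty proper \<open>L \<subset> V\<close> meets every edge \<open>e\<close> in no point or in more than
  \<open>m e\<close> points. The support is connected exactly when the full edges do not respect any partition of
  \<open>V\<close> into two nonempty parts (\<open>connected_support_iff_full_edges_connect\<close>), because two cells that
  meet share a vertex.

  Deformations are produced as supports of real vectors. Give the vertices distinct real
  parameters \<open>t v\<close> and impose on a vector \<open>a\<close> the \<open>m e\<close> Vandermonde conditions
  \<open>(\<Sum>v\<in>S e. t v ^ k * a v) = 0\<close>, \<open>k < m e\<close>, for every edge \<open>e\<close>. They force the support of \<open>a\<close> to
  miss \<open>e\<close> or to meet it in more than \<open>m e\<close> points. All edges together impose only \<open>card V - 1\<close>
  conditions, and any spare condition can be spent on making a coordinate vanish, which keeps the
  support a proper subset of \<open>V\<close>.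

  Connected implies full: if some edge carries positive weight without being full, then resetting
  such weights to \<open>0\<close> frees a condition. No full edge joins the resulting deformation to its
  complement, against connectedness.

  Rigid implies full, which is the main point (\<open>partially_full_edge_has_deformation\<close>): let \<open>e0\<close>
  carry weight \<open>0 < m < card (S e0) - 1\<close>, and drop the conditions of \<open>e0\<close>. Then at least \<open>m + 1\<close>
  degrees of freedom remain. If some nonzero solution vanishes on \<open>S e0\<close>, its support is a
  deformation. Otherwise the
  solutions restrict to a space of dimension at least \<open>m + 1\<close> on \<open>S e0\<close>. Suppose that no coordinate
  in \<open>S e0\<close> is zero on all solutions (otherwise a general solution already has a zero in \<open>S e0\<close> and
  more than \<open>m\<close> nonzero coordinates there). Call two coordinates parallel if they vanish on the same
  solutions. There are at least \<open>m + 1\<close> parallel classes on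
  the \<open>p = card (S e0) > m + 1\<close> points of \<open>S e0\<close>, so they cannot all have \<open>p - m\<close> or more elements. A
  general solution vanishing on a class with fewer than \<open>p - m\<close> elements has more than \<open>m\<close> nonzero
  coordinates on \<open>S e0\<close>, so its support is a deformation.

  Once the weighting is full, a deformation is the same as a nonempty proper subset of \<open>V\<close> that no
  full edge leaves. So rigidity becomes connectedness, and the converse direction is immediate.
\<close>

section \<open>Linear algebra of coordinate functions\<close>

text \<open>
  Gaussian elimination by induction on the number of equations: eliminate a pivot coordinate from
  the remaining equations. Working with functions on a finite set allows the number of unknowns to
  vary in the induction.
\<close>

lemma homogeneous_system_nontrivial:
  fixes c :: "'k \<Rightarrow> 'v \<Rightarrow> 'a::field"
  assumes "finite K" "finite V" "card K < card V"
  shows "\<exists>a. (\<exists>v\<in>V. a v \<noteq> 0) \<and> (\<forall>k\<in>K. (\<Sum>v\<in>V. c k v * a v) = 0)"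
  using assms
proof (induction K arbitrary: V c rule: finite_induct)
  case empty
  then have "V \<noteq> {}" by auto
  then show ?case by (intro exI[of _ "\<lambda>_. 1"]) auto
next
  case (insert k K)
  show ?case
  proof (cases "\<forall>v\<in>V. c k v = 0")
    case True
    have "\<exists>a. (\<exists>v\<in>V. a v \<noteq> 0) \<and> (\<forall>k\<in>K. (\<Sum>v\<in>V. c k v * a v) = 0)"
      by (rule insert.IH) (use insert in auto)
    then show ?thesis using True by auto
  next
    case False
    then obtain v0 where v0: "v0 \<in> V" "c k v0 \<noteq> 0" by blast
    define V' where "V' = V - {v0}"
    define c' where "c' = (\<lambda>l v. c l v - c l v0 / c k v0 * c k v)"
    have "\<exists>a. (\<exists>v\<in>V'. a v \<noteq> 0) \<and> (\<forall>k\<in>K. (\<Sum>v\<in>V'. c' k v * a v) = 0)"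
      by (rule insert.IH) (use insert v0 in \<open>auto simp: V'_def\<close>)
    then obtain a where a: "\<exists>v\<in>V'. a v \<noteq> 0" "\<And>l. l \<in> K \<Longrightarrow> (\<Sum>v\<in>V'. c' l v * a v) = 0"
      by blast
    \<comment> \<open>Solve equation \<open>k\<close> for the pivot coordinate \<open>v0\<close>.\<close>
    define s where "s = (\<Sum>v\<in>V'. c k v * a v)"
    define b where "b = a(v0 := - s / c k v0)"
    have split: "(\<Sum>v\<in>V. c l v * b v) = (\<Sum>v\<in>V'. c l v * a v) - c l v0 * s / c k v0" for l
    proof -
      have "(\<Sum>v\<in>V. c l v * b v) = c l v0 * b v0 + (\<Sum>v\<in>V'. c l v * b v)"
        unfolding V'_def by (rule sum.remove) (use insert v0 in auto)
      also have "(\<Sum>v\<in>V'. c l v * b v) = (\<Sum>v\<in>V'. c l v * a v)"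
        by (rule sum.cong) (auto simp: b_def V'_def)
      finally show ?thesis by (simp add: b_def)
    qed
    have "(\<Sum>v\<in>V. c l v * b v) = 0" if "l \<in> insert k K" for l
    proof (cases "l = k")
      case True
      then show ?thesis using split[of k] v0 by (simp add: s_def)
    next
      case False
      then have "0 = (\<Sum>v\<in>V'. c' l v * a v)" using a(2) that by simp
      also have "\<dots> = (\<Sum>v\<in>V'. c l v * a v) - c l v0 / c k v0 * s"
        by (simp add: c'_def s_def algebra_simps sum_subtractf sum_distrib_left)
      finally show ?thesis using split[of l] by simp
    qed
    moreover have "\<exists>v\<in>V. b v \<noteq> 0" using a(1) by (auto simp: b_def V'_def)
    ultimately show ?thesis by blast
  qed
qed

text \<open>
  A real subspace is not a finite union of proper subspaces: if no coordinate in \<open>J\<close> is identically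
  zero on \<open>W\<close>, a general vector of \<open>W\<close> has no zero coordinate in \<open>J\<close>.
\<close>

lemma common_nonzero_vector:
  fixes W :: "('v \<Rightarrow> real) set"
  assumes "finite J" "W \<noteq> {}"
    and lin: "\<And>u w c. u \<in> W \<Longrightarrow> w \<in> W \<Longrightarrow> (\<lambda>v. u v + c * w v) \<in> W"
    and "\<And>j. j \<in> J \<Longrightarrow> \<exists>w\<in>W. w j \<noteq> 0"
  shows "\<exists>w\<in>W. \<forall>j\<in>J. w j \<noteq> 0"
  using assms(1,4)
proof (induction J rule: finite_induct)
  case empty
  then show ?case using assms(2) by auto
next
  case (insert j J)
  then obtain w u where w: "w \<in> W" "\<forall>i\<in>J. w i \<noteq> 0" and u: "u \<in> W" "u j \<noteq> 0"
    by (meson insertI1 insertI2)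
  \<comment> \<open>Each coordinate of \<open>w + c u\<close> excludes at most one value of \<open>c\<close>.\<close>
  have "finite ((\<lambda>i. - w i / u i) ` insert j J)" using insert by auto
  then obtain c where c: "c \<notin> (\<lambda>i. - w i / u i) ` insert j J"
    using ex_new_if_finite infinite_UNIV_char_0 by blast
  have "w i + c * u i \<noteq> 0" if "i \<in> insert j J" for i
  proof
    assume z: "w i + c * u i = 0"
    have "u i \<noteq> 0" using z that w(2) u(2) by (cases "u i = 0") auto
    then have "c = - w i / u i" using z by (simp add: field_simps add_eq_0_iff)
    then show False using c that by blast
  qed
  then show ?case using lin[OF w(1) u(1), of c] by (intro bexI[of _ "\<lambda>v. w v + c * u v"]) auto
qed

text \<open>
  The hypothesis \<open>dim\<close> says that the restriction of \<open>W\<close> to \<open>P\<close> has dimension greater than \<open>m\<close>, in the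
  form in which it is used: no \<open>m\<close> coordinates determine the others. For each \<open>i\<close>, the coordinates
  forced to vanish with \<open>i\<close> form a set \<open>F i\<close>, and a general vector of \<open>W\<close> with zero \<open>i\<close>-th coordinate
  is nonzero on \<open>P - F i\<close>. If all these complements had at most \<open>m\<close> elements, then at most \<open>m\<close>
  coordinates could be chosen whose sets \<open>F\<close> cover \<open>P\<close>.
\<close>

lemma exists_vector_with_zero_and_large_support:
  fixes W :: "('v \<Rightarrow> real) set"
  assumes "finite P" "0 < m" "m + 1 < card P" "W \<noteq> {}"
    and lin: "\<And>u w c. u \<in> W \<Longrightarrow> w \<in> W \<Longrightarrow> (\<lambda>v. u v + c * w v) \<in> W"
    and dim: "\<And>R. R \<subseteq> P \<Longrightarrow> card R \<le> m \<Longrightarrow> \<exists>w\<in>W. (\<forall>r\<in>R. w r = 0) \<and> (\<exists>v\<in>P. w v \<noteq> 0)"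
  shows "\<exists>w\<in>W. (\<exists>i\<in>P. w i = 0) \<and> m < card {v\<in>P. w v \<noteq> 0}"
proof -
  define F where "F = (\<lambda>i. {j\<in>P. \<forall>w\<in>W. w i = 0 \<longrightarrow> w j = 0})"
  show ?thesis
  proof (cases "\<exists>i\<in>P. m < card (P - F i)")
    case True
    then obtain i where i: "i \<in> P" "m < card (P - F i)" by blast
    have "P - F i \<noteq> {}" using i(2) by (metis card.empty not_less_zero)
    then have "{w\<in>W. w i = 0} \<noteq> {}" by (auto simp: F_def)
    then have "\<exists>w\<in>{w\<in>W. w i = 0}. \<forall>j\<in>P - F i. w j \<noteq> 0"
      by (intro common_nonzero_vector) (use assms lin in \<open>auto simp: F_def\<close>)
    then obtain w where w: "w \<in> W" "w i = 0" "\<forall>j\<in>P - F i. w j \<noteq> 0" by blast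
    have "card (P - F i) \<le> card {v\<in>P. w v \<noteq> 0}"
      by (rule card_mono) (use assms w in auto)
    then show ?thesis using i w by force
  next
    case False
    then have small: "card (P - F i) \<le> m" if "i \<in> P" for i using that by force
    have contra: False if "R \<subseteq> P" "card R \<le> m"
      and "\<And>w v. w \<in> W \<Longrightarrow> \<forall>r\<in>R. w r = 0 \<Longrightarrow> v \<in> P \<Longrightarrow> w v = 0" for R
      using dim[OF that(1,2)] that(3) by blast
    show ?thesis
    proof (cases "\<exists>l\<in>P. \<forall>w\<in>W. w l = 0")
      case True
      then obtain l where "l \<in> P" "\<forall>w\<in>W. w l = 0" by blast
      \<comment> \<open>When \<open>l\<close> is identically zero, \<open>F l\<close> is the set of all such coordinates, and the rest is too small.\<close>
      then have l: "l \<in> P" "\<And>w. w \<in> W \<Longrightarrow> w l = 0" by blast+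
      have "w v = 0" if "w \<in> W" "\<forall>r\<in>P - F l. w r = 0" "v \<in> P" for w v
        using that l by (cases "v \<in> F l") (auto simp: F_def)
      then show ?thesis using contra[OF _ small[OF l(1)]] by blast
    next
      case False
      \<comment> \<open>Without identically zero coordinates the relation \<open>j \<in> F i\<close> means that \<open>i\<close> and \<open>j\<close> are proportional.\<close>
      have sym: "i \<in> F j" if "i \<in> P" "j \<in> F i" for i j
      proof -
        have "w i = 0" if "w \<in> W" "w j = 0" for w
        proof -
          obtain u where u: "u \<in> W" "u j \<noteq> 0" using False \<open>j \<in> F i\<close> by (auto simp: F_def)
          then have ui: "u i \<noteq> 0" using \<open>j \<in> F i\<close> by (auto simp: F_def)
          define x where "x = (\<lambda>v. w v + (- w i / u i) * u v)"
          have "x \<in> W" unfolding x_def by (rule lin) (use that u in auto)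
          moreover have "x i = 0" using ui by (simp add: x_def)
          ultimately have "x j = 0" using \<open>j \<in> F i\<close> by (simp add: F_def)
          then have "w j + (- w i / u i) * u j = 0" by (simp add: x_def)
          then show ?thesis using that u ui by simp
        qed
        then show ?thesis using \<open>i \<in> P\<close> by (auto simp: F_def)
      qed
      have "P \<noteq> {}" using assms(3) by auto
      then obtain i1 where i1: "i1 \<in> P" by blast
      obtain i2 where i2: "i2 \<in> P" "i2 \<notin> F i1"
      proof -
        have "P - F i1 \<noteq> {}"
        proof
          assume "P - F i1 = {}"
          then have "w v = 0" if "w \<in> W" "\<forall>r\<in>{i1}. w r = 0" "v \<in> P" for w v
            using that by (auto simp: F_def)
          then show False using contra[of "{i1}"] i1 assms(2)
            by (metis One_nat_def Suc_leI card_1_singleton_iff empty_subsetI insert_subset)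
        qed
        then show ?thesis using that by blast
      qed
      have disj: "F i1 \<inter> F i2 = {}"
      proof (rule ccontr)
        assume "F i1 \<inter> F i2 \<noteq> {}"
        then obtain j where "j \<in> F i1" "j \<in> F i2" by blast
        then have "j \<in> F i1" "i2 \<in> F j" using sym[of i2 j] i2 by auto
        then show False using i2 by (auto simp: F_def)
      qed
      have i2F: "i2 \<in> F i2" using i2 by (auto simp: F_def)
      have "card P = card (F i2) + card (P - F i2)"
        using card_Int_Diff[of P "F i2"] assms(1)
        by (metis (no_types, lifting) F_def Int_absorb2 Int_commute mem_Collect_eq subsetI)
      then have "1 < card (F i2)" using small[OF i2(1)] assms(3) by linarith
      then obtain j where j: "j \<in> F i2" "j \<noteq> i2"
        by (metis card_1_singleton_iff card_le_Suc0_iff_eq i2F One_nat_def card.infinite not_le less_nat_zero_code)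
      \<comment> \<open>Besides \<open>i1\<close>, keep all of the at most \<open>m\<close> coordinates outside \<open>F i1\<close> except \<open>j\<close>, which is controlled by \<open>i2\<close>.\<close>
      have jP: "j \<in> P - F i1" using j disj by (auto simp: F_def)
      let ?R = "insert i1 (P - F i1 - {j})"
      have "card ?R \<le> Suc (card (P - F i1 - {j}))" by (rule card_insert_le_m1) (use assms in \<open>auto simp: card_insert_if\<close>)
      also have "\<dots> = card (P - F i1)" using jP assms(1) by (intro card.remove[symmetric, of _ j]) auto
      finally have "card ?R \<le> m" using small[OF i1] by linarith
      moreover have "w v = 0" if "w \<in> W" "\<forall>r\<in>?R. w r = 0" "v \<in> P" for w v
      proof -
        have "w i2 = 0" using that i2 j by blast
        then have "w j = 0" using j that by (auto simp: F_def)
        moreover have "w i1 = 0" using that by blast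
        ultimately show ?thesis using that by (cases "v \<in> F i1"; cases "v = j") (auto simp: F_def)
      qed
      moreover have "?R \<subseteq> P" using i1 by blast
      ultimately show ?thesis using contra[of ?R] by blast
    qed
  qed
qed

text \<open>
  If the support \<open>T\<close> had at most \<open>m\<close> points, the interpolation polynomial vanishing at all parameters
  of \<open>T\<close> but \<open>t v0\<close> would have degree below \<open>m\<close>. Combining the conditions with its coefficients would
  isolate \<open>a v0\<close>.
\<close>

lemma vandermonde_support_gap:
  fixes t a :: "'v \<Rightarrow> real"
  assumes "finite S" "inj_on t S"
    and mom: "\<And>k. k < m \<Longrightarrow> (\<Sum>v\<in>S. t v ^ k * a v) = 0"
    and nz: "v0 \<in> S" "a v0 \<noteq> 0"
  shows "m < card {v\<in>S. a v \<noteq> 0}"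
proof (rule ccontr)
  define T where "T = {v\<in>S. a v \<noteq> 0}"
  assume "\<not> m < card {v\<in>S. a v \<noteq> 0}"
  then have T: "card T \<le> m" "finite T" "v0 \<in> T" using assms by (auto simp: T_def)
  define p where "p = (\<Prod>u\<in>T - {v0}. [:- t u, 1:])"
  have "degree p \<le> (\<Sum>u\<in>T - {v0}. 1)"
    unfolding p_def by (rule order_trans[OF degree_prod_sum_le]) (use T in auto)
  also have "\<dots> < card T" using T by (simp add: card_gt_0_iff)
       (metis One_nat_def card_gt_0_iff diff_less empty_iff zero_less_one)
  finally have deg: "degree p < m" using T by simp
  have "0 = (\<Sum>k\<le>degree p. coeff p k * (\<Sum>v\<in>S. t v ^ k * a v))"
    using mom deg by simp
  also have "\<dots> = (\<Sum>v\<in>S. poly p (t v) * a v)"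
    unfolding poly_altdef sum_distrib_left sum_distrib_right
    by (subst sum.swap) (simp add: mult.assoc)
  also have "\<dots> = poly p (t v0) * a v0"
  proof -
    have rest: "poly p (t v) * a v = 0" if "v \<in> S - {v0}" for v
    proof (cases "a v = 0")
      case False
      then have "v \<in> T - {v0}" using that by (auto simp: T_def)
      then show ?thesis unfolding p_def poly_prod using T(2) by (auto intro!: prod_zero bexI[of _ v])
    qed simp
    have "(\<Sum>v\<in>S - {v0}. poly p (t v) * a v) = 0" by (rule sum.neutral) (use rest in blast)
    then show ?thesis using assms(1) nz by (simp add: sum.remove[of S v0])
  qed
  finally have "poly p (t v0) = 0" using nz by simp
  then obtain u where "u \<in> T - {v0}" "t u = t v0"
    unfolding p_def poly_prod using T(2) by (force simp: prod_zero_iff)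
  then show False using assms(2) nz by (auto simp: T_def inj_on_def)
qed

section \<open>Rigidity in weighted hypergraphs\<close>

text \<open>
  Edges are indexed by \<open>e\<close> with vertex set \<open>S e\<close> and weight \<open>m e\<close>. Cells index their sets of lattice
  points, so that no identification of cells with vertex sets is required.
\<close>

definition deformation ::
    "'v set \<Rightarrow> 'e set \<Rightarrow> ('e \<Rightarrow> 'v set) \<Rightarrow> ('e \<Rightarrow> nat) \<Rightarrow> 'v set \<Rightarrow> bool" where
  "deformation V E S m L \<longleftrightarrow>
     L \<noteq> {} \<and> L \<subset> V \<and> (\<forall>e\<in>E. S e \<inter> L = {} \<or> m e < card (S e \<inter> L))"

text \<open>
  Connectedness is expressed by cuts: every partition of \<open>V\<close> into two nonempty parts is crossed by an
  edge of the maximal weight \<open>card (S e) - 1\<close>.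
\<close>

definition full_edges_connect ::
    "'v set \<Rightarrow> 'e set \<Rightarrow> ('e \<Rightarrow> 'v set) \<Rightarrow> ('e \<Rightarrow> nat) \<Rightarrow> bool" where
  "full_edges_connect V E S m \<longleftrightarrow>
     (\<forall>A. A \<noteq> {} \<and> A \<subset> V \<longrightarrow>
        (\<exists>e\<in>E. Suc (m e) = card (S e) \<and> S e \<inter> A \<noteq> {} \<and> \<not> S e \<subseteq> A))"

text \<open>
  The conditions at an edge are the parity checks of a Reed-Solomon code, which is what bounds the
  support of a nonzero restriction from below.
\<close>

definition moment_space ::
    "'e set \<Rightarrow> ('e \<Rightarrow> 'v set) \<Rightarrow> ('e \<Rightarrow> nat) \<Rightarrow> ('v \<Rightarrow> real) \<Rightarrow> ('v \<Rightarrow> real) set" where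
  "moment_space E S m t = {a. \<forall>e\<in>E. \<forall>k<m e. (\<Sum>v\<in>S e. t v ^ k * a v) = 0}"

lemma moment_space_linear:
  assumes "u \<in> moment_space E S m t" "w \<in> moment_space E S m t"
  shows "(\<lambda>v. u v + c * w v) \<in> moment_space E S m t"
proof -
  have "(\<Sum>v\<in>S e. t v ^ k * (u v + c * w v)) =
     (\<Sum>v\<in>S e. t v ^ k * u v) + c * (\<Sum>v\<in>S e. t v ^ k * w v)" for e k
    by (simp add: algebra_simps sum.distrib sum_distrib_left)
  then show ?thesis using assms by (simp add: moment_space_def)
qed

lemma moment_space_nontrivial:
  assumes "finite V" "finite E" "finite Z" and S: "\<And>e. e \<in> E \<Longrightarrow> S e \<subseteq> V" and "Z \<subseteq> V"
    and "sum m E + card Z < card V"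
  shows "\<exists>a \<in> moment_space E S m t. (\<forall>z\<in>Z. a z = 0) \<and> (\<exists>v\<in>V. a v \<noteq> 0)"
proof -
  define K where "K = (SIGMA e:E. {..<m e}) <+> Z"
  define c :: "('b \<times> nat) + 'a \<Rightarrow> 'a \<Rightarrow> real" where
    "c = (\<lambda>x v. case x of Inl (e, k) \<Rightarrow> if v \<in> S e then t v ^ k else 0
                        | Inr z \<Rightarrow> if v = z then 1 else 0)"
  have "finite K" using assms by (simp add: K_def)
  moreover have "card K < card V" using assms by (simp add: K_def card_Plus)
  ultimately obtain a where a: "\<exists>v\<in>V. a v \<noteq> 0" "\<And>x. x \<in> K \<Longrightarrow> (\<Sum>v\<in>V. c x v * a v) = 0"
    using homogeneous_system_nontrivial[of K V c] assms(1) by blast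
  have "a z = 0" if "z \<in> Z" for z
  proof -
    have "0 = (\<Sum>v\<in>V. c (Inr z) v * a v)" using a(2)[of "Inr z"] InrI[OF that] unfolding K_def by metis
    also have "\<dots> = (\<Sum>v\<in>V. if v = z then a v else 0)" by (rule sum.cong) (auto simp: c_def)
    also have "\<dots> = a z" using that assms by (auto simp: sum.delta)
    finally show ?thesis by simp
  qed
  moreover have "(\<Sum>v\<in>S e. t v ^ k * a v) = 0" if "e \<in> E" "k < m e" for e k
  proof -
    have "0 = (\<Sum>v\<in>V. c (Inl (e, k)) v * a v)" using a(2)[of "Inl (e, k)"] that by (auto simp: K_def)
    also have "\<dots> = (\<Sum>v\<in>V. if v \<in> S e then t v ^ k * a v else 0)"
      by (rule sum.cong) (auto simp: c_def)
    also have "\<dots> = (\<Sum>v\<in>V \<inter> S e. t v ^ k * a v)" using assms(1) by (simp add: sum.inter_restrict)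
    also have "V \<inter> S e = S e" using S that by blast
    finally show ?thesis by simp
  qed
  ultimately show ?thesis using a(1) by (auto simp: moment_space_def)
qed

lemma moment_space_support_gap:
  assumes "finite V" "inj_on t V" "S e \<subseteq> V" "e \<in> E" "a \<in> moment_space E S m t"
  shows "S e \<inter> {v\<in>V. a v \<noteq> 0} = {} \<or> m e < card (S e \<inter> {v\<in>V. a v \<noteq> 0})"
proof -
  have "S e \<inter> {v\<in>V. a v \<noteq> 0} = {v\<in>S e. a v \<noteq> 0}" using assms(3) by auto
  moreover have "m e < card {v\<in>S e. a v \<noteq> 0}" if "v0 \<in> S e" "a v0 \<noteq> 0" for v0
    by (rule vandermonde_support_gap[where t = t])
       (use assms that in \<open>auto simp: moment_space_def intro: finite_subset inj_on_subset\<close>)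
  ultimately show ?thesis by auto
qed

lemma finite_imp_real_injection:
  assumes "finite V"
  obtains t :: "'v \<Rightarrow> real" where "inj_on t V"
proof -
  obtain f :: "'v \<Rightarrow> nat" where "inj_on f V" using finite_imp_inj_to_nat_seg[OF assms] by blast
  then have "inj_on (real \<circ> f) V" by (simp add: inj_on_def)
  then show ?thesis by (rule that)
qed

text \<open>
  At least one degree of freedom is left for the equation \<open>a v0 = 0\<close>, which makes the support proper.
\<close>

lemma light_weighting_has_deformation:
  assumes "finite V" "finite E" "\<And>e. e \<in> E \<Longrightarrow> S e \<subseteq> V"
    and "sum m E + 1 < card V"
  shows "\<exists>L. deformation V E S m L"
proof -
  obtain v0 where "v0 \<in> V" using assms(4) by fastforce
  obtain t :: "'a \<Rightarrow> real" where t: "inj_on t V" using finite_imp_real_injection[OF assms(1)] .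
  have "\<exists>a \<in> moment_space E S m t. (\<forall>z\<in>{v0}. a z = 0) \<and> (\<exists>v\<in>V. a v \<noteq> 0)"
    by (rule moment_space_nontrivial) (use assms \<open>v0 \<in> V\<close> in auto)
  then obtain a where a: "a \<in> moment_space E S m t" "a v0 = 0" "\<exists>v\<in>V. a v \<noteq> 0" by blast
  have "deformation V E S m {v\<in>V. a v \<noteq> 0}"
    unfolding deformation_def
    using a assms \<open>v0 \<in> V\<close> moment_space_support_gap[OF assms(1) t assms(3) _ a(1)] by blast
  then show ?thesis by blast
qed

text \<open>
  Dropping the conditions of \<open>e0\<close> leaves a space in which any \<open>m e0\<close> further coordinates can be made
  zero. Either some nonzero solution vanishes on all of \<open>S e0\<close>, or the parallel class count of
  \<open>exists_vector_with_zero_and_large_support\<close> applies to \<open>S e0\<close>.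
\<close>

lemma partially_full_edge_has_deformation:
  assumes "finite V" "finite E" "\<And>e. e \<in> E \<Longrightarrow> S e \<subseteq> V"
    and "sum m E < card V" and e0: "e0 \<in> E" "0 < m e0" "m e0 + 1 < card (S e0)"
  shows "\<exists>L. deformation V E S m L"
proof -
  obtain t :: "'a \<Rightarrow> real" where t: "inj_on t V" using finite_imp_real_injection[OF assms(1)] .
  define W where "W = moment_space (E - {e0}) S m t"
  define L where "L = (\<lambda>w::'a \<Rightarrow> real. {v\<in>V. w v \<noteq> 0})"
  have finS: "finite (S e0)" using assms finite_subset by blast
  have gap: "S e \<inter> L w = {} \<or> m e < card (S e \<inter> L w)" if "w \<in> W" "e \<in> E" "e \<noteq> e0" for e w
    unfolding L_def
    by (rule moment_space_support_gap[OF assms(1) t, where E = "E - {e0}"])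
      (use that assms in \<open>auto simp: W_def\<close>)
  have sumE: "sum m E = m e0 + sum m (E - {e0})" using assms by (simp add: sum.remove)
  have solution: "\<exists>w\<in>W. (\<forall>r\<in>R. w r = 0) \<and> (\<exists>v\<in>V. w v \<noteq> 0)" if "R \<subseteq> S e0" "card R \<le> m e0" for R
    unfolding W_def
    by (rule moment_space_nontrivial)
      (use assms that finS sumE in \<open>auto intro: finite_subset\<close>)
  show ?thesis
  proof (cases "\<exists>w\<in>W. (\<forall>v\<in>S e0. w v = 0) \<and> (\<exists>v\<in>V. w v \<noteq> 0)")
    case True
    then obtain w where w: "w \<in> W" "\<forall>v\<in>S e0. w v = 0" "\<exists>v\<in>V. w v \<noteq> 0" by blast
    have "S e0 \<noteq> {}" using e0 by auto
    then have "L w \<subset> V" using w assms(3)[OF e0(1)] by (auto simp: L_def)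
    moreover have "S e0 \<inter> L w = {}" using w by (auto simp: L_def)
    ultimately have "deformation V E S m (L w)"
      unfolding deformation_def
    proof (intro conjI ballI)
      show "L w \<noteq> {}" using w by (auto simp: L_def)
      show "S e \<inter> L w = {} \<or> m e < card (S e \<inter> L w)" if "e \<in> E" for e
        using that gap[OF w(1)] \<open>S e0 \<inter> L w = {}\<close> by (cases "e = e0") blast+
    qed
    then show ?thesis by blast
  next
    case False
    have "\<exists>w\<in>W. (\<exists>i\<in>S e0. w i = 0) \<and> m e0 < card {v\<in>S e0. w v \<noteq> 0}"
    proof (rule exists_vector_with_zero_and_large_support)
      show "W \<noteq> {}" using solution[of "{}"] by auto
      show "\<exists>w\<in>W. (\<forall>r\<in>R. w r = 0) \<and> (\<exists>v\<in>S e0. w v \<noteq> 0)" if "R \<subseteq> S e0" "card R \<le> m e0" for R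
        using solution[OF that] False by blast
      show "(\<lambda>v. u v + c * w v) \<in> W" if "u \<in> W" "w \<in> W" for u w c
        using that moment_space_linear unfolding W_def by blast
    qed (use finS e0 in auto)
    then obtain w i where w: "w \<in> W" "i \<in> S e0" "w i = 0" "m e0 < card {v\<in>S e0. w v \<noteq> 0}"
      by blast
    have eq: "{v\<in>S e0. w v \<noteq> 0} = S e0 \<inter> L w" using assms(3)[OF e0(1)] by (auto simp: L_def)
    have "S e0 \<inter> L w \<noteq> {}" using w(4) eq by force
    moreover have "L w \<subset> V" using w assms(3)[OF e0(1)] by (auto simp: L_def)
    ultimately have "deformation V E S m (L w)"
      unfolding deformation_def
    proof (intro conjI ballI)
      show "L w \<noteq> {}" using \<open>S e0 \<inter> L w \<noteq> {}\<close> by blast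
      show "S e \<inter> L w = {} \<or> m e < card (S e \<inter> L w)" if "e \<in> E" for e
        using that gap[OF w(1)] w(4) unfolding eq by (cases "e = e0") blast+
    qed
    then show ?thesis by blast
  qed
qed

text \<open>
  A connected hypergraph on \<open>V\<close> needs total full weight at least \<open>card V - 1\<close>, so nothing is left for
  an edge that is not full. The bound is obtained by contradiction: a lighter full weighting has a
  deformation, and no full edge crosses the boundary of it.
\<close>

lemma connected_edges_imp_full:
  assumes "finite V" "finite E" "\<And>e. e \<in> E \<Longrightarrow> S e \<subseteq> V"
    and "sum m E < card V" and conn: "full_edges_connect V E S m"
    and e: "e \<in> E"
  shows "Suc (m e) = card (S e) \<or> m e = 0"
proof (rule ccontr)
  assume *: "\<not> (Suc (m e) = card (S e) \<or> m e = 0)"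
  define m' where "m' = (\<lambda>e. if Suc (m e) = card (S e) then m e else 0)"
  have "sum m' E + m e \<le> sum m E"
  proof -
    have "sum m' E = m' e + sum m' (E - {e})" "sum m E = m e + sum m (E - {e})"
      using assms by (simp_all add: sum.remove)
    moreover have "sum m' (E - {e}) \<le> sum m (E - {e})" by (rule sum_mono) (simp add: m'_def)
    ultimately show ?thesis using * by (simp add: m'_def)
  qed
  then have lt: "sum m' E + 1 < card V" using * assms by linarith
  then obtain L where L: "deformation V E S m' L"
    using light_weighting_has_deformation[of V E S m'] assms by blast
  then have "L \<noteq> {} \<and> L \<subset> V" by (simp add: deformation_def)
  then obtain f where f: "f \<in> E" "Suc (m f) = card (S f)" "S f \<inter> L \<noteq> {}" "\<not> S f \<subseteq> L"
    using conn unfolding full_edges_connect_def by metis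
  then have "m f < card (S f \<inter> L)" using L by (auto simp: deformation_def m'_def)
  moreover have "card (S f \<inter> L) < card (S f)"
    by (rule psubset_card_mono) (use f assms finite_subset in blast)+
  ultimately show False using f by linarith
qed

text \<open>
  A full edge meets a deformation in no point or in all its points, so connected full edges exclude
  deformations. Conversely, rigidity makes every edge full or of weight \<open>0\<close>, and then any set that no
  full edge leaves is a deformation, since weight \<open>0\<close> imposes no condition.
\<close>

lemma no_deformation_iff_full_edges_connect:
  assumes "finite V" "finite E" "\<And>e. e \<in> E \<Longrightarrow> S e \<subseteq> V"
    and bound: "\<And>e. e \<in> E \<Longrightarrow> m e < card (S e)" and "sum m E < card V"
  shows "(\<nexists>L. deformation V E S m L) \<longleftrightarrow> full_edges_connect V E S m"
proof
  assume rigid: "\<nexists>L. deformation V E S m L"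
  have full: "Suc (m e) = card (S e) \<or> m e = 0" if "e \<in> E" for e
    using partially_full_edge_has_deformation[of V E S m e] assms that rigid bound[OF that]
    by fastforce
  show "full_edges_connect V E S m"
    unfolding full_edges_connect_def
  proof (intro allI impI, rule ccontr)
    fix A assume A: "A \<noteq> {} \<and> A \<subset> V"
      and no: "\<not> (\<exists>e\<in>E. Suc (m e) = card (S e) \<and> S e \<inter> A \<noteq> {} \<and> \<not> S e \<subseteq> A)"
    have "S e \<inter> A = {} \<or> m e < card (S e \<inter> A)" if e: "e \<in> E" for e
    proof (cases "S e \<inter> A = {}")
      case False
      show ?thesis
      proof (cases "m e = 0")
        case True
        have "finite (S e \<inter> A)" using assms e finite_subset by blast
        then show ?thesis using False True by (simp add: card_gt_0_iff)
      next
        case nz: False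
        then have "S e \<subseteq> A" using full[OF e] no False e by metis
        then have "S e \<inter> A = S e" by blast
        then show ?thesis using bound[OF e] by simp
      qed
    qed simp
    then have "deformation V E S m A" using A by (auto simp: deformation_def)
    then show False using rigid by blast
  qed
next
  assume conn: "full_edges_connect V E S m"
  show "\<nexists>L. deformation V E S m L"
  proof
    assume "\<exists>L. deformation V E S m L"
    then obtain L where L: "deformation V E S m L" by blast
    then have "L \<noteq> {} \<and> L \<subset> V" by (simp add: deformation_def)
    then obtain f where f: "f \<in> E" "Suc (m f) = card (S f)" "S f \<inter> L \<noteq> {}" "\<not> S f \<subseteq> L"
      using conn unfolding full_edges_connect_def by metis
    then have "m f < card (S f \<inter> L)" using L by (auto simp: deformation_def)
    moreover have "card (S f \<inter> L) < card (S f)"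
      by (rule psubset_card_mono) (use f assms finite_subset in blast)+
    ultimately show False using f by linarith
  qed
qed

section \<open>The hypergraph of a lattice simplicial decomposition\<close>

lemma extreme_point_lattice_polytope:
  assumes "lattice_polytope P" "x extreme_point_of P"
  shows "x \<in> lattice_points P"
proof -
  obtain V where V: "V \<subseteq> lattice_points UNIV" "P = convex hull V"
    using assms by (auto simp: lattice_polytope_def)
  then have "x \<in> V" using assms extreme_point_of_convex_hull by blast
  then show ?thesis using V hull_subset[of V convex] by (auto simp: lattice_points_def)
qed

text \<open>
  The extreme points of a cell are lattice points and affinely span it, so there are at least
  \<open>aff_dim P + 1\<close> of them. As the cell has no more lattice points than that, the two sets agree.
\<close>

lemma simplicial_cell_lattice_points:
  assumes dec: "lattice_simplicial_decomposition \<Delta> \<P>" and P: "P \<in> \<P>"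
  shows "finite (lattice_points P)" "{x. x extreme_point_of P} = lattice_points P"
    "lattice_points P \<noteq> {}"
proof -
  have lp: "lattice_polytope P" "P \<noteq> {}"
    using dec P by (auto simp: lattice_simplicial_decomposition_def lattice_polyhedral_decomposition_def)
  then have poly: "polytope P" by (auto simp: lattice_polytope_def polytope_def)
  have "aff_dim P \<ge> 0" using lp(2) aff_dim_negative_iff[of P] by linarith
  then obtain d :: nat where d: "aff_dim P = int d" using nonneg_int_cases by blast
  then have card: "card (lattice_points P) = d + 1"
    using dec P by (auto simp: lattice_simplicial_decomposition_def num_lattice_points_def)
  let ?X = "{x. x extreme_point_of P}"
  show fin: "finite (lattice_points P)" using card card.infinite by fastforce
  show "lattice_points P \<noteq> {}" using card by auto
  have sub: "?X \<subseteq> lattice_points P" using extreme_point_lattice_polytope[OF lp(1)] by auto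
  have "P = convex hull ?X"
    using Krein_Milman_Minkowski poly polytope_imp_compact polytope_imp_convex by blast
  then have "aff_dim P = aff_dim ?X" by (metis aff_dim_convex_hull)
  also have "\<dots> \<le> int (card ?X) - 1"
    by (rule aff_dim_le_card) (use fin sub finite_subset in blast)
  finally have "card (lattice_points P) \<le> card ?X" using d card by linarith
  then show "?X = lattice_points P" using card_seteq[OF fin sub] by simp
qed

lemma complex_vertices_eq_lattice_points:
  assumes dec: "lattice_simplicial_decomposition \<Delta> \<P>"
  shows "complex_vertices \<P> = lattice_points \<Delta>"
proof
  have pd: "lattice_polyhedral_decomposition \<Delta> \<P>"
    using dec by (simp add: lattice_simplicial_decomposition_def)
  show "complex_vertices \<P> \<subseteq> lattice_points \<Delta>"
  proof
    fix v assume "v \<in> complex_vertices \<P>"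
    then have v: "{v} \<in> \<P>" by (simp add: complex_vertices_def)
    then have "v \<in> lattice_points {v}"
      using simplicial_cell_lattice_points(3)[OF dec v] by (auto simp: lattice_points_def)
    then show "v \<in> lattice_points \<Delta>"
      using v pd by (auto simp: lattice_points_def lattice_polyhedral_decomposition_def)
  qed
  show "lattice_points \<Delta> \<subseteq> complex_vertices \<P>"
  proof
    fix x assume x: "x \<in> lattice_points \<Delta>"
    then obtain P where P: "P \<in> \<P>" "x \<in> lattice_points P"
      using pd by (auto simp: lattice_points_def lattice_polyhedral_decomposition_def)
    then have "{x} face_of P"
      using simplicial_cell_lattice_points(2)[OF dec P(1)] by (auto simp: face_of_singleton)
    then have "{x} \<in> \<P>" using P(1) pd unfolding lattice_polyhedral_decomposition_def by blast
    then show "x \<in> complex_vertices \<P>" by (simp add: complex_vertices_def)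
  qed
qed

lemma finite_lattice_points_decomposition:
  assumes dec: "lattice_simplicial_decomposition \<Delta> \<P>"
  shows "finite (lattice_points \<Delta>)"
proof -
  have "lattice_points \<Delta> = (\<Union>P\<in>\<P>. lattice_points P)" "finite \<P>"
    using dec by (auto simp: lattice_simplicial_decomposition_def
        lattice_polyhedral_decomposition_def lattice_points_def)
  then show ?thesis using simplicial_cell_lattice_points(1)[OF dec] by auto
qed

text \<open>
  A nonempty intersection is itself a cell, and cells contain lattice points.
\<close>

lemma disjoint_cells_if_disjoint_lattice_points:
  assumes dec: "lattice_simplicial_decomposition \<Delta> \<P>" and "P \<in> \<P>" "Q \<in> \<P>"
    and "lattice_points P \<inter> lattice_points Q = {}"
  shows "P \<inter> Q = {}"
proof (rule ccontr)
  assume "P \<inter> Q \<noteq> {}"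
  then have "P \<inter> Q \<in> \<P>"
    using assms(1-3)
    unfolding lattice_simplicial_decomposition_def lattice_polyhedral_decomposition_def by metis
  then have "lattice_points (P \<inter> Q) \<noteq> {}" using simplicial_cell_lattice_points(3)[OF dec] by blast
  then show False using assms(4) by (auto simp: lattice_points_def)
qed

text \<open>
  A cut that no full cell crosses splits the support into two finite unions of closed cells, which
  are disjoint since cells that meet share a lattice point. Conversely, a separation of the support
  by open sets separates the vertices, and each full cell, being convex, lies on one side.
\<close>

lemma connected_support_iff_full_edges_connect:
  assumes dec: "lattice_simplicial_decomposition \<Delta> \<P>"
    and wt: "weighting \<P> \<mu>"
  shows "connected (weighting_support \<P> \<mu>) \<longleftrightarrow>
    full_edges_connect (lattice_points \<Delta>) \<P> lattice_points (\<lambda>P. nat (\<mu> P))"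
proof -
  define \<F> where "\<F> = {P \<in> \<P>. full_cell \<mu> P}"
  have pd: "lattice_polyhedral_decomposition \<Delta> \<P>"
    using dec by (simp add: lattice_simplicial_decomposition_def)
  have cell: "closed P" "connected P" if "P \<in> \<P>" for P
  proof -
    have "polytope P" using pd that
      by (auto simp: lattice_polyhedral_decomposition_def lattice_polytope_def polytope_def)
    then show "closed P" "connected P"
      using polytope_imp_closed polytope_imp_convex convex_connected by blast+
  qed
  have finP: "finite \<P>" and un: "\<Union>\<P> = \<Delta>" using pd by (auto simp: lattice_polyhedral_decomposition_def)
  have full: "Suc (nat (\<mu> P)) = card (lattice_points P) \<longleftrightarrow> full_cell \<mu> P" if "P \<in> \<P>" for P
  proof -
    have "0 \<le> \<mu> P" using wt that by (auto simp: weighting_def)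
    then show ?thesis by (auto simp: full_cell_def num_lattice_points_def)
  qed
  \<comment> \<open>A vertex cell has weight \<open>0 = 1 - 1\<close>, so it is always full.\<close>
  have vert: "{v} \<in> \<F>" if "v \<in> lattice_points \<Delta>" for v
  proof -
    have v: "{v} \<in> \<P>" using complex_vertices_eq_lattice_points[OF dec] that by (auto simp: complex_vertices_def)
    have "lattice_points {v} = {v}" using that by (auto simp: lattice_points_def)
    then show ?thesis using wt v
      by (auto simp: \<F>_def weighting_def full_cell_def num_lattice_points_def)
  qed
  have supp: "weighting_support \<P> \<mu> = \<Union>\<F>" by (simp add: \<F>_def weighting_support_def)
  show ?thesis
  proof
    assume conn: "connected (weighting_support \<P> \<mu>)"
    show "full_edges_connect (lattice_points \<Delta>) \<P> lattice_points (\<lambda>P. nat (\<mu> P))"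
      unfolding full_edges_connect_def
    proof (intro allI impI, rule ccontr)
      fix A assume A: "A \<noteq> {} \<and> A \<subset> lattice_points \<Delta>"
        and no: "\<not> (\<exists>P\<in>\<P>. Suc (nat (\<mu> P)) = card (lattice_points P) \<and>
             lattice_points P \<inter> A \<noteq> {} \<and> \<not> lattice_points P \<subseteq> A)"
      have dich: "lattice_points P \<inter> A = {} \<or> lattice_points P \<subseteq> A" if "P \<in> \<F>" for P
        using no full that by (auto simp: \<F>_def)
      define X where "X = \<Union>{P\<in>\<F>. lattice_points P \<subseteq> A}"
      define Y where "Y = \<Union>{P\<in>\<F>. lattice_points P \<inter> A = {}}"
      have "closed X" "closed Y" unfolding X_def Y_def
        using finP cell by (auto simp: \<F>_def intro!: closed_Union)
      moreover have "X \<inter> Y = {}"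
      proof -
        have "P \<inter> Q = {}" if "P \<in> \<F>" "Q \<in> \<F>" "lattice_points P \<subseteq> A" "lattice_points Q \<inter> A = {}" for P Q
          by (rule disjoint_cells_if_disjoint_lattice_points[OF dec]) (use that in \<open>auto simp: \<F>_def\<close>)
        then show ?thesis unfolding X_def Y_def by blast
      qed
      moreover have "\<Union>\<F> \<subseteq> X \<union> Y" unfolding X_def Y_def using dich by blast
      moreover have "X \<inter> \<Union>\<F> \<noteq> {}"
      proof -
        obtain v where "v \<in> A" "v \<in> lattice_points \<Delta>" using A by blast
        then show ?thesis using vert[of v] by (force simp: X_def lattice_points_def)
      qed
      moreover have "Y \<inter> \<Union>\<F> \<noteq> {}"
      proof -
        obtain v where "v \<notin> A" "v \<in> lattice_points \<Delta>" using A by blast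
        then show ?thesis using vert[of v] by (force simp: Y_def lattice_points_def)
      qed
      ultimately show False using conn unfolding supp connected_closed by blast
    qed
  next
    assume conn: "full_edges_connect (lattice_points \<Delta>) \<P> lattice_points (\<lambda>P. nat (\<mu> P))"
    show "connected (weighting_support \<P> \<mu>)"
    proof (rule ccontr)
      assume "\<not> connected (weighting_support \<P> \<mu>)"
      then obtain X Y where XY: "open X" "open Y" "\<Union>\<F> \<subseteq> X \<union> Y" "X \<inter> Y \<inter> \<Union>\<F> = {}"
        "X \<inter> \<Union>\<F> \<noteq> {}" "Y \<inter> \<Union>\<F> \<noteq> {}"
        unfolding supp connected_def by blast
      have side: "P \<subseteq> X \<and> P \<inter> Y = {} \<or> P \<subseteq> Y \<and> P \<inter> X = {}" if "P \<in> \<F>" for P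
      proof -
        have "connected P" "P \<subseteq> \<Union>\<F>" using cell that by (auto simp: \<F>_def)
        then have "X \<inter> P = {} \<or> Y \<inter> P = {}"
          by (intro connectedD[of P X Y]) (use XY in blast)+
        then show ?thesis using \<open>P \<subseteq> \<Union>\<F>\<close> XY(3) by blast
      qed
      have lat: "\<exists>v\<in>lattice_points \<Delta>. v \<in> P" if "P \<in> \<F>" for P
      proof -
        have "P \<in> \<P>" using that by (simp add: \<F>_def)
        then obtain v where "v \<in> lattice_points P"
          using simplicial_cell_lattice_points(3)[OF dec] by blast
        then show ?thesis using \<open>P \<in> \<P>\<close> un by (auto simp: lattice_points_def)
      qed
      define A where "A = lattice_points \<Delta> \<inter> X"
      obtain P Q where PQ: "P \<in> \<F>" "P \<inter> X \<noteq> {}" "Q \<in> \<F>" "Q \<inter> Y \<noteq> {}" using XY by blast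
      then have "P \<subseteq> X" "Q \<inter> X = {}" using side by blast+
      then have "A \<noteq> {}" "A \<subset> lattice_points \<Delta>"
        using lat[OF PQ(1)] lat[OF PQ(3)] by (auto simp: A_def)
      then obtain R where R: "R \<in> \<P>" "full_cell \<mu> R" "lattice_points R \<inter> A \<noteq> {}" "\<not> lattice_points R \<subseteq> A"
        using conn full unfolding full_edges_connect_def by blast
      have "R \<in> \<F>" using R by (simp add: \<F>_def)
      moreover have "lattice_points R \<subseteq> lattice_points \<Delta>" "lattice_points R \<subseteq> R"
        using R(1) un by (auto simp: lattice_points_def)
      ultimately show False using side[of R] R(3,4) by (auto simp: A_def)
    qed
  qed
qed

lemma deformable_iff_deformation:
  assumes dec: "lattice_simplicial_decomposition \<Delta> \<P>"
    and wt: "weighting \<P> \<mu>"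
  shows "deformable \<Delta> \<P> \<mu> L \<longleftrightarrow>
    deformation (lattice_points \<Delta>) \<P> lattice_points (\<lambda>P. nat (\<mu> P)) L"
proof (cases "L \<subseteq> lattice_points \<Delta>")
  case True
  have cell: "(num_lattice_points (P \<inter> L) = 0 \<or> int (num_lattice_points (P \<inter> L)) \<ge> \<mu> P + 1) \<longleftrightarrow>
     (lattice_points P \<inter> L = {} \<or> nat (\<mu> P) < card (lattice_points P \<inter> L))" if "P \<in> \<P>" for P
  proof -
    have eq: "lattice_points (P \<inter> L) = lattice_points P \<inter> L"
      by (auto simp: lattice_points_def)
    have fin: "finite (lattice_points P \<inter> L)"
      using simplicial_cell_lattice_points(1)[OF dec that] by blast
    have "0 \<le> \<mu> P" using wt that by (auto simp: weighting_def)
    then show ?thesis unfolding num_lattice_points_def eq using fin by (auto simp: nat_less_iff)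
  qed
  show ?thesis
    unfolding deformable_def deformation_def complex_vertices_eq_lattice_points[OF dec]
    using True cell by auto
next
  case False
  then show ?thesis by (auto simp: deformable_def deformation_def)
qed

theorem theorem3p5:
  fixes \<Delta> :: "(real^'n) set"
    and \<P> :: "(real^'n) set set"
    and \<mu> :: "(real^'n) set \<Rightarrow> int"
  assumes "lattice_polytope \<Delta>"
    and "lattice_simplicial_decomposition \<Delta> \<P>"
    and "weighting \<P> \<mu>"
    and "total_weight \<P> \<mu> = int (num_lattice_points \<Delta>) - 1"
  shows "(rigid \<Delta> \<P> \<mu> \<longleftrightarrow> connected (weighting_support \<P> \<mu>)) \<and>
         (connected (weighting_support \<P> \<mu>) \<longleftrightarrow>
            connected (weighting_support \<P> \<mu>) \<and> full_weighting \<P> \<mu>)"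
proof -
  let ?V = "lattice_points \<Delta>" and ?m = "\<lambda>P. nat (\<mu> P)"
  note dec = assms(2) and wt = assms(3)
  have finV: "finite ?V" by (rule finite_lattice_points_decomposition[OF dec])
  have finP: "finite \<P>" and un: "\<Union>\<P> = \<Delta>"
    using dec by (auto simp: lattice_simplicial_decomposition_def lattice_polyhedral_decomposition_def)
  have sub: "lattice_points P \<subseteq> ?V" if "P \<in> \<P>" for P using that un by (auto simp: lattice_points_def)
  have bnd: "0 \<le> \<mu> P" "\<mu> P \<le> int (card (lattice_points P)) - 1" if "P \<in> \<P>" for P
    using wt that by (auto simp: weighting_def num_lattice_points_def)
  have m: "?m P < card (lattice_points P)" if "P \<in> \<P>" for P
    using bnd[OF that] by linarith
  have "int (sum ?m \<P>) = total_weight \<P> \<mu>"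
    unfolding total_weight_def of_nat_sum by (rule sum.cong) (use bnd in auto)
  then have sum: "sum ?m \<P> < card ?V" using assms(4) unfolding num_lattice_points_def by linarith
  note supp = connected_support_iff_full_edges_connect[OF dec wt]
  have "rigid \<Delta> \<P> \<mu> \<longleftrightarrow> connected (weighting_support \<P> \<mu>)"
    unfolding rigid_def deformable_iff_deformation[OF dec wt] supp
    by (rule no_deformation_iff_full_edges_connect[OF finV finP sub m sum])
  moreover have "full_weighting \<P> \<mu>" if "connected (weighting_support \<P> \<mu>)"
    unfolding full_weighting_def num_lattice_points_def
  proof
    fix P assume P: "P \<in> \<P>"
    have "Suc (?m P) = card (lattice_points P) \<or> ?m P = 0"
      using that unfolding supp
      by (intro connected_edges_imp_full[OF finV finP sub sum]) (use P in auto)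
    then show "\<mu> P = int (card (lattice_points P)) - 1 \<or> \<mu> P = 0"
      using bnd(1)[OF P] by auto
  qed
  ultimately show ?thesis by blast
qed

end
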